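(* Let $A$ be an algebra in a congruence-distributive variety, and let $\mathcal U,\mathcal V\in\operatorname{Unif}A$. Then $[\mathcal U,\mathcal V]=\mathcal U\wedge\mathcal V$.
   Context: Algebras have finitary operations (the underlying set may be empty). A variety is congruence-distributive if every congruence lattice of a member is distributive; equivalently it has ternary (Jónsson) terms $d_0,\dots,d_k$ with $d_0(x,y,z)=x$, $d_k(x,y,z)=z$, $d_i(x,y,x)=x$ for all $i$, $d_i(x,x,y)=d_{i+1}(x,x,y)$ for even $i<k$, and $d_i(x,y,y)=d_{i+1}(x,y,y)$ for odd $i<k$. A uniformity on a set $S$ is a filter $\mathcal U$ of binary relations on $S$ such that every $U\in\mathcal U$ is reflexive, $U\in\mathcal U$ implies $U^{-1}\in\mathcal U$, and for each $U\in\mathcal U$ there is $V\in\mathcal U$ with $V\circ V\subseteq U$. A uniformity $\mathcal U$ on an algebra $A$ is compatible if for each basic operation $\omega$ and $U\in\mathcal U$ there is $\bar U\in\mathcal U$ such that $x_i\mathrel{\bar U}y_i$ for all $i$ implies $\omega(\mathbf x)\mathrel U\omega(\mathbf y)$. $\operatorname{Unif}A$ is the complete lattice of compatible uniformities on $A$, ordered by reverse inclusion ($\mathcal U\le\mathcal V$ iff $\mathcal V\subseteq\mathcal U$); thus $\mathcal U\wedge\mathcal V$ is the filter generated by $\mathcal U\cup\mathcal V$. For binary relations $U,V$ on $A$, $n,n'\ge0$ and an $(n+n')$-ary term $t$, $\mathrm M_{n,n',t}(U,V)$ is the set of matrices $\begin{pmatrix}t(\mathbf a,\mathbf b)&t(\mathbf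 a,\mathbf c)\\t(\mathbf a',\mathbf b)&t(\mathbf a',\mathbf c)\end{pmatrix}$ with $\mathbf a,\mathbf a'\in A^n$, $\mathbf b,\mathbf c\in A^{n'}$, $a_i\mathrel Ua'_i$ and $b_j\mathrel Vc_j$ for all $i,j$. The commutator $[\mathcal U,\mathcal V]$ ($A$ in a congruence-modular variety, in particular in a congruence-distributive one) is the least $\mathcal W\in\operatorname{Unif}A$ such that for all $n,n',t$ and all $W\in\mathcal W$ there are $U\in\mathcal U$, $V\in\mathcal V$, $\bar W\in\mathcal W$ such that $(u_{ij})\in\mathrm M_{n,n',t}(U,V)$ and $u_{11}\mathrel{\bar W}u_{12}$ imply $u_{21}\mathrel Wu_{22}$. *)

theory Defs
  imports Complex_Main
begin

section \<open>Algebras, terms and varieties\<close>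

text \<open>
  A signature is a partial map sending each basic operation symbol to its arity; elements of
  \<open>'f\<close> outside its domain are not symbols, so the empty signature is covered.
  Values of \<open>interp\<close> outside the domain or at argument lists of the wrong length are irrelevant.
  The underlying set may be empty.
\<close>

record ('f, 'a) alg =
  carrier :: "'a set"
  interp :: "'f \<Rightarrow> 'a list \<Rightarrow> 'a"

definition algebra :: "('f \<rightharpoonup> nat) \<Rightarrow> ('f, 'a) alg \<Rightarrow> bool" where
  "algebra sig A \<longleftrightarrow>
     (\<forall>f n xs. sig f = Some n \<and> length xs = n \<and> set xs \<subseteq> carrier A \<longrightarrow> interp A f xs \<in> carrier A)"

datatype (opsyms: 'f, vars: 'v) trm = Var 'v | Op 'f "('f, 'v) trm list"

fun wf_trm :: "('f \<rightharpoonup> nat) \<Rightarrow> ('f, 'v) trm \<Rightarrow> bool" where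
  "wf_trm sig (Var v) \<longleftrightarrow> True"
| "wf_trm sig (Op f ts) \<longleftrightarrow> sig f = Some (length ts) \<and> (\<forall>t\<in>set ts. wf_trm sig t)"

fun eval :: "('f, 'a) alg \<Rightarrow> ('v \<Rightarrow> 'a) \<Rightarrow> ('f, 'v) trm \<Rightarrow> 'a" where
  "eval A \<rho> (Var v) = \<rho> v"
| "eval A \<rho> (Op f ts) = interp A f (map (eval A \<rho>) ts)"

text \<open>The \<open>n\<close>-ary terms, in the variables \<open>0, \<dots>, n - 1\<close>, and their evaluation at an \<open>n\<close>-tuple.\<close>

definition nary_terms :: "('f \<rightharpoonup> nat) \<Rightarrow> nat \<Rightarrow> ('f, nat) trm set" where
  "nary_terms sig n = {t. wf_trm sig t \<and> vars t \<subseteq> {..<n}}"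

definition term_op :: "('f, 'a) alg \<Rightarrow> ('f, nat) trm \<Rightarrow> 'a list \<Rightarrow> 'a" where
  "term_op A t xs = eval A (\<lambda>i. xs ! i) t"

text \<open>
  A variety is the class of all models of a set of identities; countably many variables suffice
  because operations are finitary.
\<close>

definition identities :: "('f \<rightharpoonup> nat) \<Rightarrow> (('f, nat) trm \<times> ('f, nat) trm) set \<Rightarrow> bool" where
  "identities sig E \<longleftrightarrow> (\<forall>(s, t)\<in>E. wf_trm sig s \<and> wf_trm sig t)"

definition variety ::
  "('f \<rightharpoonup> nat) \<Rightarrow> (('f, nat) trm \<times> ('f, nat) trm) set \<Rightarrow> ('f, 'a) alg set" where
  "variety sig E =
     {A. algebra sig A \<and>
         (\<forall>(s, t)\<in>E. \<forall>\<rho>. range \<rho> \<subseteq> carrier A \<longrightarrow> eval A \<rho> s = eval A \<rho> t)}"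


section \<open>Congruence-distributive varieties\<close>

definition congruences :: "('f \<rightharpoonup> nat) \<Rightarrow> ('f, 'a) alg \<Rightarrow> 'a rel set" where
  "congruences sig A =
     {\<theta>. equiv (carrier A) \<theta> \<and>
         (\<forall>f n xs ys. sig f = Some n \<and> length xs = n \<and> (xs, ys) \<in> listrel \<theta> \<longrightarrow>
            (interp A f xs, interp A f ys) \<in> \<theta>)}"

definition cong_join :: "('f \<rightharpoonup> nat) \<Rightarrow> ('f, 'a) alg \<Rightarrow> 'a rel \<Rightarrow> 'a rel \<Rightarrow> 'a rel" where
  "cong_join sig A \<alpha> \<beta> = \<Inter> {\<theta> \<in> congruences sig A. \<alpha> \<union> \<beta> \<subseteq> \<theta>}"

definition distributive_congruences :: "('f \<rightharpoonup> nat) \<Rightarrow> ('f, 'a) alg \<Rightarrow> bool" where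
  "distributive_congruences sig A \<longleftrightarrow>
     (\<forall>\<alpha>\<in>congruences sig A. \<forall>\<beta>\<in>congruences sig A. \<forall>\<gamma>\<in>congruences sig A.
        \<alpha> \<inter> cong_join sig A \<beta> \<gamma> = cong_join sig A (\<alpha> \<inter> \<beta>) (\<alpha> \<inter> \<gamma>))"

text \<open>
  A formula of HOL cannot quantify over types, so the type \<open>'u\<close> in which the members of the variety
  are taken is a parameter. It must be large enough: for \<open>'u = ('f, nat) trm set\<close> the members
  include (as a set of classes of terms) the free algebra on countably many generators, hence
  distributivity for the members in this type already yields Jonsson terms, and so distributivity
  for the members in every type.
\<close>

definition congruence_distributive ::
  "'u itself \<Rightarrow> ('f \<rightharpoonup> nat) \<Rightarrow> (('f, nat) trm \<times> ('f, nat) trm) set \<Rightarrow> bool" where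
  "congruence_distributive _ sig E \<longleftrightarrow>
     (\<forall>B :: ('f, 'u) alg. B \<in> variety sig E \<longrightarrow> distributive_congruences sig B)"


section \<open>Compatible uniformities\<close>

text \<open>
  A filter of binary relations on \<open>S\<close> is represented by a library filter on pairs that is
  concentrated on \<open>S \<times> S\<close>; its members are recovered as the entourages. The library order is
  reverse inclusion, so that \<open>inf\<close> is the filter generated by the union. The improper filter
  \<open>bot\<close> is a uniformity only for \<open>S = {}\<close>.
\<close>

definition entourages :: "'a set \<Rightarrow> ('a \<times> 'a) filter \<Rightarrow> 'a rel set" where
  "entourages S \<U> = {U. U \<subseteq> S \<times> S \<and> (\<forall>\<^sub>F p in \<U>. p \<in> U)}"

definition uniformity_on :: "'a set \<Rightarrow> ('a \<times> 'a) filter \<Rightarrow> bool" where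
  "uniformity_on S \<U> \<longleftrightarrow>
     \<U> \<le> principal (S \<times> S) \<and>
     (\<forall>U\<in>entourages S \<U>. refl_on S U \<and> U\<inverse> \<in> entourages S \<U> \<and> (\<exists>V\<in>entourages S \<U>. V O V \<subseteq> U))"

definition compatible :: "('f \<rightharpoonup> nat) \<Rightarrow> ('f, 'a) alg \<Rightarrow> ('a \<times> 'a) filter \<Rightarrow> bool" where
  "compatible sig A \<U> \<longleftrightarrow>
     (\<forall>f n. sig f = Some n \<longrightarrow>
        (\<forall>U\<in>entourages (carrier A) \<U>. \<exists>U'\<in>entourages (carrier A) \<U>.
           \<forall>xs ys. length xs = n \<and> (xs, ys) \<in> listrel U' \<longrightarrow>
             (interp A f xs, interp A f ys) \<in> U))"

definition Unif :: "('f \<rightharpoonup> nat) \<Rightarrow> ('f, 'a) alg \<Rightarrow> ('a \<times> 'a) filter set" where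
  "Unif sig A = {\<U>. uniformity_on (carrier A) \<U> \<and> compatible sig A \<U>}"

lemma entourages_inf:
  assumes "\<U> \<le> principal (S \<times> S)" "\<V> \<le> principal (S \<times> S)"
  shows "entourages S (inf \<U> \<V>) =
    {W. W \<subseteq> S \<times> S \<and> (\<exists>U\<in>entourages S \<U>. \<exists>V\<in>entourages S \<V>. U \<inter> V \<subseteq> W)}"
proof (intro equalityI subsetI)
  fix W assume W: "W \<in> entourages S (inf \<U> \<V>)"
  then obtain P Q where PQ: "eventually P \<U>" "eventually Q \<V>" "\<And>p. P p \<and> Q p \<Longrightarrow> p \<in> W"
    unfolding entourages_def eventually_inf by blast
  have S: "\<forall>\<^sub>F p in \<U>. p \<in> S \<times> S" "\<forall>\<^sub>F p in \<V>. p \<in> S \<times> S"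
    using assms by (simp_all add: le_principal)
  have "{p \<in> S \<times> S. P p} \<in> entourages S \<U>" "{p \<in> S \<times> S. Q p} \<in> entourages S \<V>"
    using eventually_conj[OF S(1) PQ(1)] eventually_conj[OF S(2) PQ(2)]
    by (auto simp: entourages_def)
  moreover have "{p \<in> S \<times> S. P p} \<inter> {p \<in> S \<times> S. Q p} \<subseteq> W" using PQ(3) by blast
  moreover have "W \<subseteq> S \<times> S" using W by (simp add: entourages_def)
  ultimately show "W \<in> {W. W \<subseteq> S \<times> S \<and> (\<exists>U\<in>entourages S \<U>. \<exists>V\<in>entourages S \<V>. U \<inter> V \<subseteq> W)}"
    by blast
next
  fix W assume "W \<in> {W. W \<subseteq> S \<times> S \<and> (\<exists>U\<in>entourages S \<U>. \<exists>V\<in>entourages S \<V>. U \<inter> V \<subseteq> W)}"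
  then obtain U V where "W \<subseteq> S \<times> S" "U \<in> entourages S \<U>" "V \<in> entourages S \<V>" "U \<inter> V \<subseteq> W"
    by blast
  then have "eventually (\<lambda>p. p \<in> U) \<U>" "eventually (\<lambda>p. p \<in> V) \<V>" "W \<subseteq> S \<times> S"
      "\<forall>p. p \<in> U \<and> p \<in> V \<longrightarrow> p \<in> W"
    by (auto simp: entourages_def)
  then show "W \<in> entourages S (inf \<U> \<V>)"
    unfolding entourages_def eventually_inf by blast
qed

lemma entourages_mono:
  assumes "\<U> \<le> principal (S \<times> S)" "\<V> \<le> principal (S \<times> S)"
  shows "\<U> \<le> \<V> \<longleftrightarrow> entourages S \<V> \<subseteq> entourages S \<U>"
proof
  assume "\<U> \<le> \<V>"
  then show "entourages S \<V> \<subseteq> entourages S \<U>"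
    unfolding entourages_def using filter_leD by blast
next
  assume sub: "entourages S \<V> \<subseteq> entourages S \<U>"
  show "\<U> \<le> \<V>"
  proof (rule filter_leI)
    fix P assume P: "eventually P \<V>"
    have "\<forall>\<^sub>F p in \<V>. p \<in> S \<times> S" using assms(2) by (simp add: le_principal)
    from eventually_conj[OF this P] have "{p \<in> S \<times> S. P p} \<in> entourages S \<V>"
      by (simp add: entourages_def)
    with sub have "\<forall>\<^sub>F p in \<U>. p \<in> {p \<in> S \<times> S. P p}"
      unfolding entourages_def by blast
    then show "eventually P \<U>" by (rule eventually_mono) simp
  qed
qed


section \<open>The commutator\<close>

text \<open>\<open>((u11, u12), (u21, u22))\<close> encodes the matrix with rows \<open>(u11, u12)\<close> and \<open>(u21, u22)\<close>.\<close>

definition term_matrices ::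
  "('f, 'a) alg \<Rightarrow> nat \<Rightarrow> nat \<Rightarrow> ('f, nat) trm \<Rightarrow> 'a rel \<Rightarrow> 'a rel \<Rightarrow> (('a \<times> 'a) \<times> ('a \<times> 'a)) set"
  where
  "term_matrices A n n' t U V =
     {((term_op A t (a @ b), term_op A t (a @ c)), (term_op A t (a' @ b), term_op A t (a' @ c)))
      | a a' b c.
        length a = n \<and> length a' = n \<and> length b = n' \<and> length c = n' \<and>
        set a \<subseteq> carrier A \<and> set a' \<subseteq> carrier A \<and> set b \<subseteq> carrier A \<and> set c \<subseteq> carrier A \<and>
        (a, a') \<in> listrel U \<and> (b, c) \<in> listrel V}"

definition term_condition ::
  "('f \<rightharpoonup> nat) \<Rightarrow> ('f, 'a) alg \<Rightarrow>
   ('a \<times> 'a) filter \<Rightarrow> ('a \<times> 'a) filter \<Rightarrow> ('a \<times> 'a) filter \<Rightarrow> bool" where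
  "term_condition sig A \<U> \<V> \<W> \<longleftrightarrow>
     (\<forall>n n'. \<forall>t\<in>nary_terms sig (n + n'). \<forall>W\<in>entourages (carrier A) \<W>.
        \<exists>U\<in>entourages (carrier A) \<U>. \<exists>V\<in>entourages (carrier A) \<V>. \<exists>W'\<in>entourages (carrier A) \<W>.
          \<forall>u11 u12 u21 u22. ((u11, u12), (u21, u22)) \<in> term_matrices A n n' t U V \<and> (u11, u12) \<in> W' \<longrightarrow>
            (u21, u22) \<in> W)"

definition commutator ::
  "('f \<rightharpoonup> nat) \<Rightarrow> ('f, 'a) alg \<Rightarrow> ('a \<times> 'a) filter \<Rightarrow> ('a \<times> 'a) filter \<Rightarrow> ('a \<times> 'a) filter" where
  "commutator sig A \<U> \<V> = (LEAST \<W>. \<W> \<in> Unif sig A \<and> term_condition sig A \<U> \<V> \<W>)"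

end

theory Submission
  imports Defs
begin

text \<open>
  The meet satisfies the term condition because the rows of a matrix are linked through both
  uniformities. Conversely, distributivity of the congruences of the free algebra over \<open>A\<close> on
  the variables \<open>x\<close>, \<open>y\<close>, \<open>z\<close> yields a chain of terms from \<open>x\<close> to \<open>z\<close>, all satisfying
  \<open>t(x,y,x) = x\<close>, consecutive members of which agree either whenever \<open>x = y\<close> or whenever
  \<open>y = z\<close>. If \<open>\<W>\<close> satisfies the term condition and \<open>(x, y)\<close> lies in small entourages of both
  \<open>\<U>\<close> and \<open>\<V>\<close>, then the matrix with first row \<open>t(x,x,x) = x = t(x,y,x)\<close> and second row
  \<open>t(x,x,y)\<close>, \<open>t(x,y,y)\<close> shows that the latter two are \<open>\<W>\<close>-close. Following the chain,
  \<open>x\<close> is \<open>\<W>\<close>-close to \<open>y\<close>.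
\<close>

section \<open>Entourages\<close>

lemma entouragesD: "U \<in> entourages S \<U> \<Longrightarrow> U \<subseteq> S \<times> S"
  by (simp add: entourages_def)

lemma entourages_Int:
  "U \<in> entourages S \<U> \<Longrightarrow> V \<in> entourages S \<U> \<Longrightarrow> U \<inter> V \<in> entourages S \<U>"
  by (auto simp: entourages_def eventually_conj_iff)

lemma full_entourage: "\<U> \<le> principal (S \<times> S) \<Longrightarrow> S \<times> S \<in> entourages S \<U>"
  by (simp add: entourages_def le_principal)

text \<open>Entourages are closed under finite intersections, and \<open>P\<close> survives
  shrinking. The empty case falls back on the full square. This handles all arguments of one
  operation symbol at once.\<close>

lemma finite_uniform_entourage:
  assumes "finite T" "\<U> \<le> principal (S \<times> S)"
    and "\<And>t. t \<in> T \<Longrightarrow> \<exists>U\<in>entourages S \<U>. P t U"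
    and antimono: "\<And>t U U'. P t U \<Longrightarrow> U' \<subseteq> U \<Longrightarrow> P t U'"
  shows "\<exists>U\<in>entourages S \<U>. \<forall>t\<in>T. P t U"
  using assms(1,3)
proof (induction T)
  case empty
  then show ?case using full_entourage[OF assms(2)] by blast
next
  case (insert t T)
  obtain U where U: "U \<in> entourages S \<U>" "\<forall>t\<in>T. P t U" using insert by blast
  obtain U' where U': "U' \<in> entourages S \<U>" "P t U'" using insert.prems by blast
  have "\<forall>s\<in>insert t T. P s (U \<inter> U')"
    using U(2) U'(2) antimono by (metis Int_lower1 Int_lower2 insert_iff)
  then show ?case using entourages_Int[OF U(1) U'(1)] by blast
qed

lemma uniformity_le: "uniformity_on S \<U> \<Longrightarrow> \<U> \<le> principal (S \<times> S)"
  by (simp add: uniformity_on_def)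

lemma uniformity_refl:
  "uniformity_on S \<U> \<Longrightarrow> U \<in> entourages S \<U> \<Longrightarrow> x \<in> S \<Longrightarrow> (x, x) \<in> U"
  by (auto simp: uniformity_on_def refl_on_def)

lemma uniformity_converse:
  "uniformity_on S \<U> \<Longrightarrow> U \<in> entourages S \<U> \<Longrightarrow> U\<inverse> \<in> entourages S \<U>"
  by (simp add: uniformity_on_def)

lemma uniformity_half:
  "uniformity_on S \<U> \<Longrightarrow> U \<in> entourages S \<U> \<Longrightarrow> \<exists>V\<in>entourages S \<U>. V O V \<subseteq> U"
  by (simp add: uniformity_on_def)

lemma uniformity_third_sym:
  assumes "uniformity_on S \<U>" "U \<in> entourages S \<U>"
  shows "\<exists>V\<in>entourages S \<U>. sym V \<and> V O V O V \<subseteq> U"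
proof -
  obtain V where V: "V \<in> entourages S \<U>" "V O V \<subseteq> U" using uniformity_half assms by blast
  obtain V' where V': "V' \<in> entourages S \<U>" "V' O V' \<subseteq> V"
    using uniformity_half assms(1) V(1) by blast
  have "V' \<inter> V'\<inverse> \<in> entourages S \<U>"
    using entourages_Int[OF V'(1) uniformity_converse[OF assms(1) V'(1)]] .
  moreover have "sym (V' \<inter> V'\<inverse>)" by (auto simp: sym_def)
  \<comment> \<open>Reflexivity puts \<open>V'\<close> inside \<open>V' O V'\<close>. In the triple
    composition two factors then fit into one \<open>V\<close> and the third into another.\<close>
  moreover have "V' \<subseteq> V"
    using V'(2) entouragesD[OF V'(1)] uniformity_refl[OF assms(1) V'(1)] by fastforce
  with V(2) V'(2) have "(V' \<inter> V'\<inverse>) O (V' \<inter> V'\<inverse>) O (V' \<inter> V'\<inverse>) \<subseteq> U" by blast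
  ultimately show ?thesis by blast
qed

section \<open>Meets of compatible uniformities\<close>

text \<open>The sets \<open>U \<inter> V\<close> form a base of the meet, so each axiom can be
  checked separately in the two components.\<close>

lemma uniformity_on_inf:
  assumes U: "uniformity_on S \<U>" and V: "uniformity_on S \<V>"
  shows "uniformity_on S (inf \<U> \<V>)"
proof -
  note E = entourages_inf[OF uniformity_le[OF U] uniformity_le[OF V]]
  have "refl_on S W \<and> W\<inverse> \<in> entourages S (inf \<U> \<V>) \<and>
      (\<exists>W'\<in>entourages S (inf \<U> \<V>). W' O W' \<subseteq> W)"
    if "W \<in> entourages S (inf \<U> \<V>)" for W
  proof -
    obtain U0 V0 where W: "W \<subseteq> S \<times> S" "U0 \<in> entourages S \<U>" "V0 \<in> entourages S \<V>"
        "U0 \<inter> V0 \<subseteq> W"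
      using \<open>W \<in> _\<close> unfolding E by blast
    have "refl_on S W"
      using W uniformity_refl[OF U W(2)] uniformity_refl[OF V W(3)] by (auto simp: refl_on_def)
    moreover have "U0\<inverse> \<inter> V0\<inverse> \<subseteq> W\<inverse>" "W\<inverse> \<subseteq> S \<times> S" using W(1,4) by auto
    then have "W\<inverse> \<in> entourages S (inf \<U> \<V>)"
      unfolding E using uniformity_converse[OF U W(2)] uniformity_converse[OF V W(3)] by blast
    moreover obtain U1 V1 where 1: "U1 \<in> entourages S \<U>" "V1 \<in> entourages S \<V>"
        "U1 O U1 \<subseteq> U0" "V1 O V1 \<subseteq> V0"
      using uniformity_half[OF U W(2)] uniformity_half[OF V W(3)] by blast
    then have "U1 \<inter> V1 \<in> entourages S (inf \<U> \<V>)"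
      unfolding E using entouragesD by blast
    moreover have "(U1 \<inter> V1) O (U1 \<inter> V1) \<subseteq> W" using 1 W(4) by blast
    ultimately show ?thesis by blast
  qed
  moreover have "inf \<U> \<V> \<le> principal (S \<times> S)" using uniformity_le[OF U] by (simp add: le_infI1)
  ultimately show ?thesis by (simp add: uniformity_on_def)
qed

lemma listrel_weaken:
  "(xs, ys) \<in> listrel R \<Longrightarrow> R \<subseteq> R' \<Longrightarrow> (xs, ys) \<in> listrel R'"
  using listrel_mono by blast

lemma compatible_inf:
  assumes U: "uniformity_on (carrier A) \<U>" "compatible sig A \<U>"
    and V: "uniformity_on (carrier A) \<V>" "compatible sig A \<V>"
  shows "compatible sig A (inf \<U> \<V>)"
  unfolding compatible_def
proof (intro allI impI ballI)
  let ?S = "carrier A"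
  note E = entourages_inf[OF uniformity_le[OF U(1)] uniformity_le[OF V(1)]]
  fix f n W assume f: "sig f = Some n" and "W \<in> entourages ?S (inf \<U> \<V>)"
  then obtain U0 V0 where W: "U0 \<in> entourages ?S \<U>" "V0 \<in> entourages ?S \<V>" "U0 \<inter> V0 \<subseteq> W"
    unfolding E by blast
  obtain U1 where U1: "U1 \<in> entourages ?S \<U>"
      "\<And>xs ys. length xs = n \<Longrightarrow> (xs, ys) \<in> listrel U1 \<Longrightarrow> (interp A f xs, interp A f ys) \<in> U0"
    using U(2) f W(1) unfolding compatible_def by blast
  obtain V1 where V1: "V1 \<in> entourages ?S \<V>"
      "\<And>xs ys. length xs = n \<Longrightarrow> (xs, ys) \<in> listrel V1 \<Longrightarrow> (interp A f xs, interp A f ys) \<in> V0"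
    using V(2) f W(2) unfolding compatible_def by blast
  have "U1 \<inter> V1 \<in> entourages ?S (inf \<U> \<V>)"
    unfolding E using U1(1) V1(1) entouragesD by blast
  moreover have "(interp A f xs, interp A f ys) \<in> W"
    if "length xs = n" "(xs, ys) \<in> listrel (U1 \<inter> V1)" for xs ys
    using U1(2) V1(2) W(3) that listrel_weaken[OF that(2)] by blast
  ultimately show "\<exists>W'\<in>entourages ?S (inf \<U> \<V>). \<forall>xs ys. length xs = n \<and> (xs, ys) \<in> listrel W' \<longrightarrow>
      (interp A f xs, interp A f ys) \<in> W"
    by blast
qed

lemma Unif_inf:
  "\<U> \<in> Unif sig A \<Longrightarrow> \<V> \<in> Unif sig A \<Longrightarrow> inf \<U> \<V> \<in> Unif sig A"
  by (simp add: Unif_def uniformity_on_inf compatible_inf)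

section \<open>Uniform continuity of terms\<close>

text \<open>Compatibility passes from basic operations to terms by induction: the entourage demanded
  at the root is pulled back through the operation, then through the finitely many subterms.\<close>

lemma compatible_eval:
  fixes A :: "('f, 'a) alg" and t :: "('f, 'v) trm"
  assumes "compatible sig A \<U>" "\<U> \<le> principal (carrier A \<times> carrier A)"
  shows "wf_trm sig t \<Longrightarrow> U \<in> entourages (carrier A) \<U> \<Longrightarrow>
    \<exists>U'\<in>entourages (carrier A) \<U>. \<forall>\<rho> \<rho>'. (\<forall>i\<in>vars t. (\<rho> i, \<rho>' i) \<in> U') \<longrightarrow>
      (eval A \<rho> t, eval A \<rho>' t) \<in> U"
proof (induction t arbitrary: U)
  case (Var v)
  then show ?case by auto
next
  case (Op f ts)
  have sig: "sig f = Some (length ts)" "\<And>t. t \<in> set ts \<Longrightarrow> wf_trm sig t" using Op.prems(1) by auto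
  obtain U1 where U1: "U1 \<in> entourages (carrier A) \<U>"
    "\<And>xs ys. length xs = length ts \<Longrightarrow> (xs, ys) \<in> listrel U1 \<Longrightarrow>
      (interp A f xs, interp A f ys) \<in> U"
    using assms(1)[unfolded compatible_def, rule_format, OF sig(1) Op.prems(2)] by blast
  define P where "P = (\<lambda>(t :: ('f, 'v) trm) U'. \<forall>\<rho> \<rho>'.
    (\<forall>i\<in>vars t. (\<rho> i, \<rho>' i) \<in> U') \<longrightarrow> (eval A \<rho> t, eval A \<rho>' t) \<in> U1)"
  have "\<exists>U'\<in>entourages (carrier A) \<U>. \<forall>t\<in>set ts. P t U'"
  proof (rule finite_uniform_entourage[OF finite_set assms(2)])
    fix t assume "t \<in> set ts"
    then show "\<exists>U'\<in>entourages (carrier A) \<U>. P t U'"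
      unfolding P_def using Op.IH sig(2) U1(1) by simp
  next
    fix t U2 U3 assume "P t U2" "U3 \<subseteq> U2"
    then show "P t U3" unfolding P_def by (meson subsetD)
  qed
  then obtain U' where U': "U' \<in> entourages (carrier A) \<U>"
    "\<And>t \<rho> \<rho>'. t \<in> set ts \<Longrightarrow> (\<forall>i\<in>vars t. (\<rho> i, \<rho>' i) \<in> U') \<Longrightarrow>
      (eval A \<rho> t, eval A \<rho>' t) \<in> U1"
    unfolding P_def by blast
  have "(eval A \<rho> (Op f ts), eval A \<rho>' (Op f ts)) \<in> U"
    if "\<forall>i\<in>vars (Op f ts). (\<rho> i, \<rho>' i) \<in> U'" for \<rho> \<rho>'
  proof -
    have "(eval A \<rho> t, eval A \<rho>' t) \<in> U1" if "t \<in> set ts" for t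
      using U'(2)[OF that] that \<open>\<forall>i\<in>vars (Op f ts). _\<close> by simp
    then have "(map (eval A \<rho>) ts, map (eval A \<rho>') ts) \<in> listrel U1"
      by (simp add: listrel_iff_nth)
    then show ?thesis using U1(2) by simp
  qed
  then show ?case using U'(1) by blast
qed

lemma compatible_term_op:
  assumes "\<U> \<in> Unif sig A" "t \<in> nary_terms sig n" "U \<in> entourages (carrier A) \<U>"
  shows "\<exists>U'\<in>entourages (carrier A) \<U>. \<forall>xs ys. length xs = n \<and> (xs, ys) \<in> listrel U' \<longrightarrow>
    (term_op A t xs, term_op A t ys) \<in> U"
proof -
  have t: "wf_trm sig t" "vars t \<subseteq> {..<n}" using assms(2) by (auto simp: nary_terms_def)
  have "compatible sig A \<U>" "\<U> \<le> principal (carrier A \<times> carrier A)"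
    using assms(1) by (auto simp: Unif_def uniformity_le)
  from compatible_eval[OF this t(1) assms(3)] obtain U' where U': "U' \<in> entourages (carrier A) \<U>"
    "\<And>\<rho> \<rho>'. (\<forall>i\<in>vars t. (\<rho> i, \<rho>' i) \<in> U') \<Longrightarrow> (eval A \<rho> t, eval A \<rho>' t) \<in> U" by blast
  have "(term_op A t xs, term_op A t ys) \<in> U" if "length xs = n" "(xs, ys) \<in> listrel U'" for xs ys
    unfolding term_op_def using t(2) that by (intro U'(2)) (auto simp: listrel_iff_nth)
  then show ?thesis using U'(1) by blast
qed

section \<open>The term condition for the meet\<close>

lemma listrel_append:
  "(xs, ys) \<in> listrel R \<Longrightarrow> (xs', ys') \<in> listrel R \<Longrightarrow> (xs @ xs', ys @ ys') \<in> listrel R"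
  by (induction rule: listrel.induct) (auto intro: listrel.intros)

lemma listrel_same: "(\<And>x. x \<in> set xs \<Longrightarrow> (x, x) \<in> R) \<Longrightarrow> (xs, xs) \<in> listrel R"
  by (induction xs) (auto intro: listrel.intros)

text \<open>The columns of a matrix are \<U>-close because \<open>a\<close> and \<open>a'\<close>
  are, so \<U>-closeness travels along u21, u11, u12, u22. The second row is \<V>-close outright,
  because \<open>b\<close> and \<open>c\<close> are and \<open>a'\<close> stays fixed.\<close>

lemma term_condition_inf:
  assumes U: "\<U> \<in> Unif sig A" and V: "\<V> \<in> Unif sig A"
  shows "term_condition sig A \<U> \<V> (inf \<U> \<V>)"
  unfolding term_condition_def
proof (intro allI ballI)
  let ?S = "carrier A"
  have uU: "uniformity_on ?S \<U>" and uV: "uniformity_on ?S \<V>" using U V by (auto simp: Unif_def)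
  note E = entourages_inf[OF uniformity_le[OF uU] uniformity_le[OF uV]]
  fix n n' t W assume t: "t \<in> nary_terms sig (n + n')" and "W \<in> entourages ?S (inf \<U> \<V>)"
  then obtain U0 V0 where W: "U0 \<in> entourages ?S \<U>" "V0 \<in> entourages ?S \<V>" "U0 \<inter> V0 \<subseteq> W"
    unfolding E by blast
  obtain U1 where U1: "U1 \<in> entourages ?S \<U>" "sym U1" "U1 O U1 O U1 \<subseteq> U0"
    using uniformity_third_sym[OF uU W(1)] by blast
  obtain U2 where U2: "U2 \<in> entourages ?S \<U>" "\<And>xs ys. length xs = n + n' \<Longrightarrow>
      (xs, ys) \<in> listrel U2 \<Longrightarrow> (term_op A t xs, term_op A t ys) \<in> U1"
    using compatible_term_op[OF U t U1(1)] by blast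
  obtain V2 where V2: "V2 \<in> entourages ?S \<V>" "\<And>xs ys. length xs = n + n' \<Longrightarrow>
      (xs, ys) \<in> listrel V2 \<Longrightarrow> (term_op A t xs, term_op A t ys) \<in> V0"
    using compatible_term_op[OF V t W(2)] by blast
  \<comment> \<open>\<open>U1\<close> itself serves as \<open>W'\<close>: only \<U>-closeness of the
    first row enters, so the \<V>-part is the full square.\<close>
  have U1_inf: "U1 \<in> entourages ?S (inf \<U> \<V>)"
    unfolding E using U1(1) full_entourage[OF uniformity_le[OF uV]] entouragesD by blast
  have close: "(u21, u22) \<in> W"
    if M: "((u11, u12), (u21, u22)) \<in> term_matrices A n n' t U2 V2" and u: "(u11, u12) \<in> U1"
    for u11 u12 u21 u22
  proof -
    obtain a a' b c where abc: "length a = n" "length a' = n" "length b = n'" "length c = n'"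
      "set a \<subseteq> ?S" "set a' \<subseteq> ?S" "set b \<subseteq> ?S" "set c \<subseteq> ?S"
      "(a, a') \<in> listrel U2" "(b, c) \<in> listrel V2"
      "u11 = term_op A t (a @ b)" "u12 = term_op A t (a @ c)"
      "u21 = term_op A t (a' @ b)" "u22 = term_op A t (a' @ c)"
      using M unfolding term_matrices_def mem_Collect_eq prod.inject
      by (elim exE conjE) (rule that; assumption)
    have refl: "(b, b) \<in> listrel U2" "(c, c) \<in> listrel U2" "(a', a') \<in> listrel V2"
      by (rule listrel_same, use abc(6-8) uniformity_refl[OF uU U2(1)] uniformity_refl[OF uV V2(1)]
        in auto)+
    have "(u11, u21) \<in> U1" "(u12, u22) \<in> U1"
      unfolding abc(11-14) using abc(1-4)
      by (auto intro!: U2(2) listrel_append[OF abc(9) refl(1)] listrel_append[OF abc(9) refl(2)])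
    then have "(u21, u11) \<in> U1" "(u12, u22) \<in> U1" using U1(2) by (simp_all add: symD)
    then have "(u21, u22) \<in> U0" using u U1(3) by blast
    moreover have "(u21, u22) \<in> V0"
      unfolding abc(11-14) using abc(2,3) by (auto intro!: V2(2) listrel_append[OF refl(3) abc(10)])
    ultimately show ?thesis using W(3) by blast
  qed
  show "\<exists>U\<in>entourages ?S \<U>. \<exists>V\<in>entourages ?S \<V>. \<exists>W'\<in>entourages ?S (inf \<U> \<V>).
      \<forall>u11 u12 u21 u22. ((u11, u12), (u21, u22)) \<in> term_matrices A n n' t U V \<and> (u11, u12) \<in> W' \<longrightarrow>
        (u21, u22) \<in> W"
    by (rule bexI[OF _ U2(1)], rule bexI[OF _ V2(1)], rule bexI[OF _ U1_inf]) (use close in blast)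
qed


section \<open>Joins of congruences\<close>

lemma congruence_refl: "\<theta> \<in> congruences sig A \<Longrightarrow> x \<in> carrier A \<Longrightarrow> (x, x) \<in> \<theta>"
  by (auto simp: congruences_def equiv_def refl_on_def)

lemma congruence_subset: "\<theta> \<in> congruences sig A \<Longrightarrow> \<theta> \<subseteq> carrier A \<times> carrier A"
  by (auto simp: congruences_def elim: equivE)

lemma congruence_interp:
  "\<theta> \<in> congruences sig A \<Longrightarrow> sig f = Some (length xs) \<Longrightarrow> (xs, ys) \<in> listrel \<theta> \<Longrightarrow>
    (interp A f xs, interp A f ys) \<in> \<theta>"
  by (auto simp: congruences_def)

text \<open>Compatibility is the only real issue. One argument is moved along a finite path of
  links, each in \<alpha> or \<beta>, while the others rest by reflexivity; then the arguments are
  replaced one after another.\<close>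

lemma trancl_Un_congruence:
  assumes \<alpha>: "\<alpha> \<in> congruences sig A" and \<beta>: "\<beta> \<in> congruences sig A"
  shows "(\<alpha> \<union> \<beta>)\<^sup>+ \<in> congruences sig A"
proof -
  let ?S = "carrier A" and ?J = "(\<alpha> \<union> \<beta>)\<^sup>+"
  have J: "?J \<subseteq> ?S \<times> ?S"
    using congruence_subset[OF \<alpha>] congruence_subset[OF \<beta>] by (intro trancl_subset_Sigma) blast
  have equiv: "equiv ?S ?J"
  proof (rule equivI)
    show "refl_on ?S ?J" using congruence_refl[OF \<alpha>] J by (auto simp: refl_on_def)
    have "sym (\<alpha> \<union> \<beta>)" using \<alpha> \<beta> by (auto simp: congruences_def elim!: equivE intro: sym_Un)
    then show "sym ?J" by (rule sym_trancl)
  qed (use J in simp_all)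
  have step: "(interp A f (pre @ x # xs), interp A f (pre @ y # xs)) \<in> ?J"
    if xy: "(x, y) \<in> ?J" and f: "sig f = Some (length (pre @ x # xs))"
      and sub: "set pre \<subseteq> ?S" "set xs \<subseteq> ?S" for f pre x y xs
  proof -
    have one: "(interp A f (pre @ u # xs), interp A f (pre @ v # xs)) \<in> ?J"
      if "(u, v) \<in> \<alpha> \<union> \<beta>" for u v
    proof -
      have "(interp A f (pre @ u # xs), interp A f (pre @ v # xs)) \<in> \<theta>"
        if \<theta>: "\<theta> \<in> congruences sig A" "(u, v) \<in> \<theta>" for \<theta>
        using f sub congruence_refl[OF \<theta>(1)] \<theta>(2)
        by (intro congruence_interp[OF \<theta>(1)] listrel_append listrel.Cons listrel_same) auto
      with \<alpha> \<beta> that show ?thesis by blast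
    qed
    show ?thesis using xy by induction (auto intro: one trancl_trans)
  qed
  \<comment> \<open>The list \<open>pre\<close> collects the arguments already replaced, hence the
    generalisation over it in the induction; it is empty at the start.\<close>
  have "(interp A f (pre @ xs), interp A f (pre @ ys)) \<in> ?J"
    if "(xs, ys) \<in> listrel ?J" "sig f = Some (length (pre @ xs))" "set pre \<subseteq> ?S" for f pre xs ys
    using that
  proof (induction arbitrary: pre rule: listrel.induct)
    case Nil
    have "(pre, pre) \<in> listrel \<alpha>"
      using Nil.prems congruence_refl[OF \<alpha>] by (intro listrel_same) auto
    then have "(interp A f pre, interp A f pre) \<in> \<alpha>" using \<alpha> Nil by (auto intro: congruence_interp)
    then show ?case by auto
  next
    case (Cons x y xs ys)
    have "y \<in> ?S" using Cons.hyps J by blast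
    have "(xs, ys) \<in> listrel (?S \<times> ?S)" using Cons.hyps(2) J by (rule listrel_weaken)
    then have "set xs \<subseteq> ?S" by (auto simp: listrel_iff_nth in_set_conv_nth)
    then have "(interp A f (pre @ x # xs), interp A f (pre @ y # xs)) \<in> ?J"
      using Cons by (intro step) auto
    also have "(interp A f (pre @ y # xs), interp A f (pre @ y # ys)) \<in> ?J"
      using Cons.IH[of "pre @ [y]"] Cons.prems \<open>y \<in> ?S\<close> by simp
    finally show ?case .
  qed
  from this[of _ _ _ "[]"] show ?thesis
    using equiv by (auto simp: congruences_def)
qed

text \<open>This turns membership in a join, as delivered by distributivity, into a finite chain of
  links.\<close>

lemma cong_join_subset_trancl:
  "\<alpha> \<in> congruences sig A \<Longrightarrow> \<beta> \<in> congruences sig A \<Longrightarrow> cong_join sig A \<alpha> \<beta> \<subseteq> (\<alpha> \<union> \<beta>)\<^sup>+"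
  using trancl_Un_congruence[of \<alpha> sig A \<beta>] by (auto simp: cong_join_def)


section \<open>The relatively free algebra of an algebra\<close>

definition assigns :: "('f, 'a) alg \<Rightarrow> (nat \<Rightarrow> 'a) set" where
  "assigns A = {\<rho>. range \<rho> \<subseteq> carrier A}"

definition term_class :: "('f \<rightharpoonup> nat) \<Rightarrow> ('f, 'a) alg \<Rightarrow> ('f, nat) trm \<Rightarrow> ('f, nat) trm set" where
  "term_class sig A t = {s. wf_trm sig s \<and> (\<forall>\<rho>\<in>assigns A. eval A \<rho> s = eval A \<rho> t)}"

text \<open>Terms modulo the identities valid in \<open>A\<close>: the free algebra on countably
  many generators in the variety generated by \<open>A\<close>. Its elements are sets of terms,
  which places it in the type where distributivity is assumed. If \<open>A\<close> is empty, so is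
  \<open>assigns A\<close>, and all terms fall into one class.\<close>

definition free_alg :: "('f \<rightharpoonup> nat) \<Rightarrow> ('f, 'a) alg \<Rightarrow> ('f, ('f, nat) trm set) alg" where
  "free_alg sig A = \<lparr>carrier = term_class sig A ` {t. wf_trm sig t},
     interp = \<lambda>f Xs. term_class sig A (Op f (map (\<lambda>X. SOME t. t \<in> X) Xs))\<rparr>"

text \<open>For \<open>D \<subseteq> assigns A\<close>, this is the kernel of the homomorphism from
  the free algebra to the power of \<open>A\<close> indexed by \<open>D\<close> that evaluates a
  term at every member of \<open>D\<close>.\<close>

definition eval_kernel ::
  "('f \<rightharpoonup> nat) \<Rightarrow> ('f, 'a) alg \<Rightarrow> (nat \<Rightarrow> 'a) set \<Rightarrow> ('f, nat) trm set rel" where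
  "eval_kernel sig A D = {(term_class sig A s, term_class sig A t) | s t.
     wf_trm sig s \<and> wf_trm sig t \<and> (\<forall>\<rho>\<in>D. eval A \<rho> s = eval A \<rho> t)}"

lemma eval_closed:
  "algebra sig A \<Longrightarrow> wf_trm sig t \<Longrightarrow> \<rho> \<in> assigns A \<Longrightarrow> eval A \<rho> t \<in> carrier A"
proof (induction t)
  case (Var v)
  then show ?case by (auto simp: assigns_def)
next
  case (Op f ts)
  then have "set (map (eval A \<rho>) ts) \<subseteq> carrier A" by auto
  then show ?case using Op.prems by (simp add: algebra_def)
qed

lemma term_class_eq_iff:
  assumes "wf_trm sig s"
  shows "term_class sig A s = term_class sig A t \<longleftrightarrow> (\<forall>\<rho>\<in>assigns A. eval A \<rho> s = eval A \<rho> t)"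
proof
  assume "term_class sig A s = term_class sig A t"
  moreover have "s \<in> term_class sig A s" using assms by (simp add: term_class_def)
  ultimately show "\<forall>\<rho>\<in>assigns A. eval A \<rho> s = eval A \<rho> t" by (simp add: term_class_def)
qed (simp add: term_class_def)

lemma some_term_class:
  fixes A :: "('f, 'a) alg"
  assumes "wf_trm sig t"
  defines "s \<equiv> SOME s. s \<in> term_class sig A t"
  shows "wf_trm sig s" "\<forall>\<rho>\<in>assigns A. eval A \<rho> s = eval A \<rho> t"
proof -
  have "t \<in> term_class sig A t" using assms(1) by (simp add: term_class_def)
  then have "s \<in> term_class sig A t" unfolding s_def by (rule someI)
  then show "wf_trm sig s" "\<forall>\<rho>\<in>assigns A. eval A \<rho> s = eval A \<rho> t"
    by (simp_all add: term_class_def)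
qed

text \<open>The representatives picked by \<open>SOME\<close> agree with \<open>ts\<close> under
  every assignment, so the resulting class does not depend on the choice.\<close>

lemma interp_free_alg:
  assumes "sig f = Some (length ts)" "\<forall>t\<in>set ts. wf_trm sig t"
  shows "interp (free_alg sig A) f (map (term_class sig A) ts) = term_class sig A (Op f ts)"
proof -
  let ?ss = "map (\<lambda>X. SOME t. t \<in> X) (map (term_class sig A) ts)"
  have "wf_trm sig (Op f ?ss)" using assms some_term_class by auto
  moreover have "map (eval A \<rho>) ?ss = map (eval A \<rho>) ts" if "\<rho> \<in> assigns A" for \<rho>
    using assms(2) some_term_class(2)[of sig _ A] that by simp
  ultimately have "term_class sig A (Op f ?ss) = term_class sig A (Op f ts)"
    by (simp add: term_class_eq_iff del: map_map map_eq_conv)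
  then show ?thesis by (simp add: free_alg_def)
qed

lemma free_alg_list:
  assumes "set Xs \<subseteq> carrier (free_alg sig A)"
  obtains ts where "Xs = map (term_class sig A) ts" "\<forall>t\<in>set ts. wf_trm sig t"
  using assms
proof (induction Xs arbitrary: thesis)
  case (Cons X Xs)
  obtain ts where "Xs = map (term_class sig A) ts" "\<forall>t\<in>set ts. wf_trm sig t"
    using Cons by auto
  moreover obtain t where "X = term_class sig A t" "wf_trm sig t"
    using Cons.prems by (auto simp: free_alg_def)
  ultimately show ?case using Cons.prems(1)[of "t # ts"] by simp
qed simp

lemma algebra_free_alg: "algebra sig (free_alg sig A)"
  unfolding algebra_def
proof (intro allI impI, elim conjE)
  fix f n Xs assume f: "sig f = Some n" "length Xs = n" and Xs: "set Xs \<subseteq> carrier (free_alg sig A)"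
  obtain ts where ts: "Xs = map (term_class sig A) ts" "\<forall>t\<in>set ts. wf_trm sig t"
    using free_alg_list[OF Xs] by blast
  with f show "interp (free_alg sig A) f Xs \<in> carrier (free_alg sig A)"
    by (auto simp: interp_free_alg) (auto simp: free_alg_def)
qed

section \<open>Substitution and identities of the free algebra\<close>

fun subst :: "(nat \<Rightarrow> ('f, nat) trm) \<Rightarrow> ('f, nat) trm \<Rightarrow> ('f, nat) trm" where
  "subst \<sigma> (Var v) = \<sigma> v"
| "subst \<sigma> (Op f ts) = Op f (map (subst \<sigma>) ts)"

lemma wf_subst: "(\<And>v. wf_trm sig (\<sigma> v)) \<Longrightarrow> wf_trm sig t \<Longrightarrow> wf_trm sig (subst \<sigma> t)"
  by (induction t) auto

lemma eval_subst: "eval A \<rho> (subst \<sigma> t) = eval A (\<lambda>v. eval A \<rho> (\<sigma> v)) t"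
proof (induction t)
  case (Op f ts)
  then have "map (eval A \<rho> \<circ> subst \<sigma>) ts = map (eval A (\<lambda>v. eval A \<rho> (\<sigma> v))) ts"
    by simp
  then show ?case by (simp del: map_eq_conv)
qed simp

lemma eval_free_alg:
  assumes "\<And>v. wf_trm sig (\<sigma> v)"
  shows "wf_trm sig t \<Longrightarrow>
    eval (free_alg sig A) (\<lambda>v. term_class sig A (\<sigma> v)) t = term_class sig A (subst \<sigma> t)"
proof (induction t)
  case (Op f ts)
  let ?F = "free_alg sig A"
  have "map (eval ?F (\<lambda>v. term_class sig A (\<sigma> v))) ts = map (term_class sig A) (map (subst \<sigma>) ts)"
    using Op by simp
  then have "eval ?F (\<lambda>v. term_class sig A (\<sigma> v)) (Op f ts)
      = interp ?F f (map (term_class sig A) (map (subst \<sigma>) ts))"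
    by (simp only: eval.simps)
  also have "\<dots> = term_class sig A (Op f (map (subst \<sigma>) ts))"
    using Op.prems by (intro interp_free_alg) (auto intro: wf_subst[OF assms])
  finally show ?case by simp
qed simp

text \<open>A valuation in the free algebra is a substitution \<sigma> read modulo classes. Applying
  \<sigma> to both sides of an identity and then evaluating in \<open>A\<close> is one more instance
  of that identity in \<open>A\<close>.\<close>

lemma free_alg_variety:
  assumes "identities sig E" and A: "A \<in> variety sig E"
  shows "free_alg sig A \<in> variety sig E"
  unfolding variety_def
proof (intro CollectI conjI algebra_free_alg, clarify)
  fix s t and \<rho> :: "nat \<Rightarrow> ('a, nat) trm set"
  assume st: "(s, t) \<in> E" and \<rho>: "range \<rho> \<subseteq> carrier (free_alg sig A)"
  have wf: "wf_trm sig s" "wf_trm sig t" using assms(1) st by (auto simp: identities_def)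
  have "\<forall>v. \<exists>u. wf_trm sig u \<and> \<rho> v = term_class sig A u" using \<rho> by (auto simp: free_alg_def)
  then obtain \<sigma> where \<sigma>: "\<And>v. wf_trm sig (\<sigma> v)" "\<rho> = (\<lambda>v. term_class sig A (\<sigma> v))" by metis
  have "eval A \<tau> (subst \<sigma> s) = eval A \<tau> (subst \<sigma> t)" if "\<tau> \<in> assigns A" for \<tau>
  proof -
    have "range (\<lambda>v. eval A \<tau> (\<sigma> v)) \<subseteq> carrier A"
      using eval_closed[OF _ \<sigma>(1) that] A by (auto simp: variety_def)
    then show ?thesis using A st unfolding eval_subst variety_def by blast
  qed
  then show "eval (free_alg sig A) \<rho> s = eval (free_alg sig A) \<rho> t"
    unfolding \<sigma>(2) using wf
    by (simp add: eval_free_alg[OF \<sigma>(1)] term_class_eq_iff wf_subst[OF \<sigma>(1)])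
qed

section \<open>Kernels of evaluation\<close>

text \<open>Since \<open>D \<subseteq> assigns A\<close>, terms of the same class agree on
  \<open>D\<close>, so the existentially chosen representatives may be exchanged for the given
  ones.\<close>

lemma eval_kernel_iff:
  assumes "wf_trm sig s" "wf_trm sig t" "D \<subseteq> assigns A"
  shows "(term_class sig A s, term_class sig A t) \<in> eval_kernel sig A D \<longleftrightarrow>
    (\<forall>\<rho>\<in>D. eval A \<rho> s = eval A \<rho> t)"
proof
  assume "(term_class sig A s, term_class sig A t) \<in> eval_kernel sig A D"
  then obtain s' t' where st: "term_class sig A s = term_class sig A s'"
    "term_class sig A t = term_class sig A t'" "\<forall>\<rho>\<in>D. eval A \<rho> s' = eval A \<rho> t'"
    by (auto simp: eval_kernel_def)
  then show "\<forall>\<rho>\<in>D. eval A \<rho> s = eval A \<rho> t"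
    using assms(3) st(1)[unfolded term_class_eq_iff[OF assms(1)]]
      st(2)[unfolded term_class_eq_iff[OF assms(2)]] by (simp add: subset_iff)
qed (use assms in \<open>auto simp: eval_kernel_def\<close>)

lemma eval_kernel_congruence:
  assumes "D \<subseteq> assigns A"
  shows "eval_kernel sig A D \<in> congruences sig (free_alg sig A)"
proof -
  let ?F = "free_alg sig A" and ?K = "eval_kernel sig A D"
  have sub: "?K \<subseteq> carrier ?F \<times> carrier ?F" by (auto simp: eval_kernel_def free_alg_def)
  have "equiv (carrier ?F) ?K"
  proof (rule equivI)
    show "refl_on (carrier ?F) ?K" using sub
      by (auto simp: refl_on_def free_alg_def eval_kernel_iff assms)
    show "sym ?K"
    proof (rule symI)
      fix X Y assume "(X, Y) \<in> ?K"
      moreover from this obtain s t where "X = term_class sig A s" "Y = term_class sig A t"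
        "wf_trm sig s" "wf_trm sig t"
        unfolding eval_kernel_def by blast
      ultimately show "(Y, X) \<in> ?K" by (simp add: eval_kernel_iff assms)
    qed
    show "trans ?K"
    proof (rule transI)
      fix X Y Z assume "(X, Y) \<in> ?K" "(Y, Z) \<in> ?K"
      moreover from this obtain s t u where "X = term_class sig A s" "Y = term_class sig A t"
        "Z = term_class sig A u" "wf_trm sig s" "wf_trm sig t" "wf_trm sig u"
        unfolding eval_kernel_def by blast
      ultimately show "(X, Z) \<in> ?K" by (simp add: eval_kernel_iff assms)
    qed
  qed (use sub in simp_all)
  moreover have "(interp ?F f Xs, interp ?F f Ys) \<in> ?K"
    if f: "sig f = Some (length Xs)" and XY: "(Xs, Ys) \<in> listrel ?K" for f Xs Ys
  proof -
    have "(Xs, Ys) \<in> listrel (carrier ?F \<times> carrier ?F)" using XY sub by (rule listrel_weaken)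
    then have "set Xs \<subseteq> carrier ?F" "set Ys \<subseteq> carrier ?F"
      by (auto simp: listrel_iff_nth in_set_conv_nth)
    then obtain ss ts where st: "Xs = map (term_class sig A) ss" "\<forall>t\<in>set ss. wf_trm sig t"
      "Ys = map (term_class sig A) ts" "\<forall>t\<in>set ts. wf_trm sig t"
      using free_alg_list by metis
    have len: "length ss = length ts" using XY st by (auto simp: listrel_iff_nth)
    have "map (eval A \<rho>) ss = map (eval A \<rho>) ts" if "\<rho> \<in> D" for \<rho>
    proof (rule nth_equalityI)
      fix i assume i: "i < length (map (eval A \<rho>) ss)"
      then have "(term_class sig A (ss ! i), term_class sig A (ts ! i)) \<in> ?K"
        using XY st len by (auto simp: listrel_iff_nth)
      then show "map (eval A \<rho>) ss ! i = map (eval A \<rho>) ts ! i"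
        using i st(2,4) len that by (simp add: eval_kernel_iff assms)
    qed (simp add: len)
    then show ?thesis using st len f by (simp add: interp_free_alg eval_kernel_iff assms)
  qed
  ultimately show ?thesis by (auto simp: congruences_def)
qed

text \<open>Agreement on both sets is agreement on their union. Hence intersections of kernels are
  again kernels, and so congruences.\<close>

lemma eval_kernel_Int:
  assumes "D \<subseteq> assigns A" "D' \<subseteq> assigns A"
  shows "eval_kernel sig A D \<inter> eval_kernel sig A D' = eval_kernel sig A (D \<union> D')"
proof -
  have "p \<in> eval_kernel sig A D \<inter> eval_kernel sig A D' \<longleftrightarrow> p \<in> eval_kernel sig A (D \<union> D')" for p
  proof (cases "\<exists>s t. wf_trm sig s \<and> wf_trm sig t \<and> p = (term_class sig A s, term_class sig A t)")
    case True
    then show ?thesis using assms by (auto simp: eval_kernel_iff)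
  qed (auto simp: eval_kernel_def)
  then show ?thesis by blast
qed


section \<open>Chains of terms\<close>

text \<open>The variables \<open>0\<close>, \<open>1\<close>, \<open>2\<close> play the roles of \<open>x\<close>, \<open>y\<close>, \<open>z\<close>; the terms may contain
  further variables.\<close>

definition jonsson_step :: "('f \<rightharpoonup> nat) \<Rightarrow> ('f, 'a) alg \<Rightarrow> ('f, nat) trm rel" where
  "jonsson_step sig A = {(s, t). wf_trm sig s \<and> wf_trm sig t \<and>
     (\<forall>\<rho>\<in>assigns A. \<rho> 0 = \<rho> 2 \<longrightarrow> eval A \<rho> s = eval A \<rho> t) \<and>
     ((\<forall>\<rho>\<in>assigns A. \<rho> 0 = \<rho> 1 \<longrightarrow> eval A \<rho> s = eval A \<rho> t) \<or>
      (\<forall>\<rho>\<in>assigns A. \<rho> 1 = \<rho> 2 \<longrightarrow> eval A \<rho> s = eval A \<rho> t))}"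

text \<open>Jonsson's argument: \<open>Var 0\<close> and \<open>Var 2\<close> are related by
  \<open>K 0 2\<close>, and through \<open>Var 1\<close> by the join of \<open>K 0 1\<close> and
  \<open>K 1 2\<close>. Distributing the intersection over the join gives a chain whose links all
  lie in \<open>K 0 2\<close> and also in \<open>K 0 1\<close> or \<open>K 1 2\<close>.\<close>

lemma jonsson_chain:
  assumes "identities sig E"
    and "congruence_distributive TYPE(('f, nat) trm set) sig (E :: (('f, nat) trm \<times> ('f, nat) trm) set)"
    and "A \<in> variety sig E"
  shows "(Var 0, Var 2) \<in> (jonsson_step sig A)\<^sup>+"
proof -
  let ?F = "free_alg sig A" and ?c = "term_class sig A"
  define D where "D = (\<lambda>i j. {\<rho> \<in> assigns A. \<rho> i = \<rho> j})"
  have D: "D i j \<subseteq> assigns A" for i j by (auto simp: D_def)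
  \<comment> \<open>The congruence that identifies the generators \<open>i\<close> and
    \<open>j\<close>.\<close>
  define K where "K = (\<lambda>i j. eval_kernel sig A (D i j))"
  have K: "K i j \<in> congruences sig ?F" for i j unfolding K_def by (rule eval_kernel_congruence[OF D])
  have K_iff: "(?c s, ?c t) \<in> K i j \<longleftrightarrow> (\<forall>\<rho>\<in>assigns A. \<rho> i = \<rho> j \<longrightarrow> eval A \<rho> s = eval A \<rho> t)"
    if "wf_trm sig s" "wf_trm sig t" for s t i j
    unfolding K_def eval_kernel_iff[OF that D] by (auto simp: D_def)
  have Var: "(?c (Var i), ?c (Var j)) \<in> K i j" for i j
    by (simp add: K_iff)
  have KK: "K i j \<inter> K i' j' \<in> congruences sig ?F" for i j i' j'
    unfolding K_def eval_kernel_Int[OF D D] using D by (intro eval_kernel_congruence) blast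
  have "(?c (Var 0), ?c (Var 2)) \<in> cong_join sig ?F (K 0 1) (K 1 2)"
    unfolding cong_join_def
  proof (intro InterI, clarify)
    fix \<theta> assume \<theta>: "\<theta> \<in> congruences sig ?F" "K 0 1 \<union> K 1 2 \<subseteq> \<theta>"
    have "trans \<theta>" using \<theta>(1) by (auto simp: congruences_def elim: equivE)
    then show "(?c (Var 0), ?c (Var 2)) \<in> \<theta>"
      using \<theta>(2) Var[of 0 1] Var[of 1 2] by (blast dest: transD)
  qed
  moreover have "distributive_congruences sig ?F"
    using assms(2) free_alg_variety[OF assms(1,3)] by (simp add: congruence_distributive_def)
  then have "K 0 2 \<inter> cong_join sig ?F (K 0 1) (K 1 2)
      = cong_join sig ?F (K 0 2 \<inter> K 0 1) (K 0 2 \<inter> K 1 2)"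
    using K unfolding distributive_congruences_def by simp
  ultimately have "(?c (Var 0), ?c (Var 2)) \<in> cong_join sig ?F (K 0 2 \<inter> K 0 1) (K 0 2 \<inter> K 1 2)"
    using Var[of 0 2] by blast
  then have chain: "(?c (Var 0), ?c (Var 2)) \<in> (K 0 2 \<inter> K 0 1 \<union> K 0 2 \<inter> K 1 2)\<^sup>+" (is "_ \<in> ?R\<^sup>+")
    using cong_join_subset_trancl[OF KK KK] by blast
  have step_terms: "(s, t) \<in> jonsson_step sig A" if "wf_trm sig s" "wf_trm sig t" "(?c s, ?c t) \<in> ?R" for s t
    using that(3) unfolding Un_iff Int_iff K_iff[OF that(1,2)] jonsson_step_def
    by (simp add: that(1,2)) blast
  \<comment> \<open>Lifts the chain from classes to terms. Quantifying over all representatives of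
    the endpoint makes the choice at each intermediate class immaterial.\<close>
  have "\<forall>t. wf_trm sig t \<longrightarrow> X = ?c t \<longrightarrow> (Var 0, t) \<in> (jonsson_step sig A)\<^sup>+"
    if "(?c (Var 0), X) \<in> ?R\<^sup>+" for X
    using that
  proof induction
    case (base Y)
    have "wf_trm sig (Var 0)" by simp
    from step_terms[OF this] base show ?case by blast
  next
    case (step Y Z)
    obtain s where s: "wf_trm sig s" "Y = ?c s"
      using step.hyps(2) unfolding K_def eval_kernel_def by blast
    then have "(Var 0, s) \<in> (jonsson_step sig A)\<^sup>+" using step.IH by blast
    then show ?case
      using step.hyps(2) s step_terms[OF s(1)] by (blast intro: trancl.trancl_into_trancl)
  qed
  with chain show ?thesis by simp
qed

section \<open>From the term condition to closeness along the chain\<close>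

text \<open>The terms of the chain may involve variables above 2. These receive the default
  \<open>x\<close>, so that every term acts as a ternary one.\<close>

definition assign3 :: "'a \<Rightarrow> 'a \<Rightarrow> 'a \<Rightarrow> nat \<Rightarrow> 'a" where
  "assign3 x y z = (\<lambda>i. if i = 1 then y else if i = 2 then z else x)"

lemma assign3_simps [simp]:
  "assign3 x y z 0 = x" "assign3 x y z (Suc 0) = y" "assign3 x y z 2 = z"
  by (simp_all add: assign3_def)

lemma assign3_assigns [simp]:
  "x \<in> carrier A \<Longrightarrow> y \<in> carrier A \<Longrightarrow> z \<in> carrier A \<Longrightarrow> assign3 x y z \<in> assigns A"
  by (auto simp: assign3_def assigns_def)

lemma term_condition_middle:
  assumes W: "uniformity_on (carrier A) \<W>" "term_condition sig A \<U> \<V> \<W>"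
    and U: "uniformity_on (carrier A) \<U>"
    and t: "wf_trm sig t" "\<And>\<rho>. \<rho> \<in> assigns A \<Longrightarrow> \<rho> 0 = \<rho> 2 \<Longrightarrow> eval A \<rho> t = \<rho> 0"
    and "W \<in> entourages (carrier A) \<W>"
  shows "\<exists>U\<in>entourages (carrier A) \<U>. \<exists>V\<in>entourages (carrier A) \<V>. \<forall>x y.
    (x, y) \<in> U \<inter> V \<longrightarrow> (eval A (assign3 x x y) t, eval A (assign3 x y y) t) \<in> W"
proof -
  \<comment> \<open>The term condition wants the variables moved along \<open>\<U>\<close> first, so \<open>y\<close> and \<open>z\<close> trade places;
    superfluous variables become \<open>x\<close>.\<close>
  define t' where "t' = subst (\<lambda>i. Var (if i = 1 then 2 else if i = 2 then 1 else 0)) t"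
  have vars: "vars (subst (\<lambda>i. Var (r i)) s) \<subseteq> range r" for r and s :: "('b, nat) trm"
    by (induction s) auto
  have "vars t' \<subseteq> {..<2 + 1}" using vars[of "\<lambda>i. if i = 1 then 2 else if i = 2 then 1 else 0" t]
    unfolding t'_def by auto
  then have "t' \<in> nary_terms sig (2 + 1)"
    using wf_subst[OF _ t(1)] by (auto simp: nary_terms_def t'_def)
  then obtain U V W' where UVW: "U \<in> entourages (carrier A) \<U>" "V \<in> entourages (carrier A) \<V>"
    "W' \<in> entourages (carrier A) \<W>"
    "\<And>u11 u12 u21 u22. ((u11, u12), (u21, u22)) \<in> term_matrices A 2 1 t' U V \<Longrightarrow>
      (u11, u12) \<in> W' \<Longrightarrow> (u21, u22) \<in> W"
    using W(2) \<open>W \<in> _\<close> unfolding term_condition_def by meson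
  have op: "term_op A t' [x, z, y] = eval A (assign3 x y z) t" for x y z
    unfolding term_op_def t'_def eval_subst
    by (rule arg_cong[where f = "\<lambda>\<rho>. eval A \<rho> t"]) (auto simp: assign3_def)
  have "(eval A (assign3 x x y) t, eval A (assign3 x y y) t) \<in> W" if xy: "(x, y) \<in> U \<inter> V" for x y
  proof -
    have S: "x \<in> carrier A" "y \<in> carrier A" using xy entouragesD[OF UVW(1)] by auto
    have "([x, x], [x, y]) \<in> listrel U" "([x], [y]) \<in> listrel V"
      using xy uniformity_refl[OF U UVW(1) S(1)] by (auto intro!: listrel.intros)
    then have "((term_op A t' ([x, x] @ [x]), term_op A t' ([x, x] @ [y])),
        (term_op A t' ([x, y] @ [x]), term_op A t' ([x, y] @ [y]))) \<in> term_matrices A 2 1 t' U V"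
      unfolding term_matrices_def using S
      by (intro CollectI exI[of _ "[x, x]"] exI[of _ "[x, y]"] exI[of _ "[x]"] exI[of _ "[y]"]) simp
    \<comment> \<open>Both entries of the first row collapse to \<open>x\<close>, as variables 0 and
      2 take the same value there. The row is thus diagonal and lies in any
      \<open>W'\<close>.\<close>
    then have "((x, x), (eval A (assign3 x x y) t, eval A (assign3 x y y) t)) \<in> term_matrices A 2 1 t' U V"
      using S by (simp add: op t(2))
    then show ?thesis using UVW(4) uniformity_refl[OF W(1) UVW(3) S(1)] by blast
  qed
  then show ?thesis using UVW(1,2) by blast
qed

text \<open>Induction along the chain shows that \<open>x\<close> stays \<W>-close to the value of
  each term at \<open>(x, x, y)\<close>. At the last term, \<open>Var 2\<close>, this value is
  \<open>y\<close>.\<close>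

lemma inf_le_term_condition:
  fixes A :: "('f, 'a) alg"
  assumes chain: "(Var 0, Var 2) \<in> (jonsson_step sig A)\<^sup>+"
    and U: "uniformity_on (carrier A) \<U>" and V: "uniformity_on (carrier A) \<V>"
    and W: "uniformity_on (carrier A) \<W>" "term_condition sig A \<U> \<V> \<W>"
  shows "inf \<U> \<V> \<le> \<W>"
proof -
  let ?S = "carrier A"
  note le = uniformity_le[OF U] uniformity_le[OF V] uniformity_le[OF W(1)]
  \<comment> \<open>Holds at \<open>Var 0\<close>, and every link preserves values under assignments
    with \<open>\<rho> 0 = \<rho> 2\<close>.\<close>
  have idem: "wf_trm sig t \<and> (\<forall>\<rho>\<in>assigns A. \<rho> 0 = \<rho> 2 \<longrightarrow> eval A \<rho> t = \<rho> 0)"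
    if "(Var 0, t) \<in> (jonsson_step sig A)\<^sup>+" for t
    using that by induction (auto simp: jonsson_step_def)
  define close where "close = (\<lambda>W (t :: ('f, nat) trm) U V. \<forall>x y.
    (x, y) \<in> U \<inter> V \<longrightarrow> (x, eval A (assign3 x x y) t) \<in> W)"
  have chain_close: "\<forall>W\<in>entourages ?S \<W>. \<exists>U\<in>entourages ?S \<U>. \<exists>V\<in>entourages ?S \<V>. close W t U V"
    if "(Var 0, t) \<in> (jonsson_step sig A)\<^sup>*" for t
    using that
  proof induction
    case base
    have "close W (Var 0) (?S \<times> ?S) (?S \<times> ?S)" if "W \<in> entourages ?S \<W>" for W
      unfolding close_def using uniformity_refl[OF W(1) that] by simp
    then show ?case using full_entourage[OF le(1)] full_entourage[OF le(2)] by blast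
  next
    case (step s t)
    show ?case
    proof
      fix W0 assume W0: "W0 \<in> entourages ?S \<W>"
      show "\<exists>U\<in>entourages ?S \<U>. \<exists>V\<in>entourages ?S \<V>. close W0 t U V"
      proof (cases "\<forall>\<rho>\<in>assigns A. \<rho> 0 = \<rho> 1 \<longrightarrow> eval A \<rho> s = eval A \<rho> t")
        \<comment> \<open>Here \<open>s\<close> and \<open>t\<close> already agree at
          \<open>(x, x, y)\<close>, so the same entourages work for \<open>t\<close>.\<close>
        case True
        obtain U0 V0 where 0: "U0 \<in> entourages ?S \<U>" "V0 \<in> entourages ?S \<V>" "close W0 s U0 V0"
          using step.IH W0 by blast
        have "eval A (assign3 x x y) s = eval A (assign3 x x y) t" if "(x, y) \<in> U0 \<inter> V0" for x y
        proof -
          have "x \<in> ?S" "y \<in> ?S" using that entouragesD[OF 0(1)] by auto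
          then show ?thesis using True by simp
        qed
        then have "close W0 t U0 V0" using 0(3) by (simp add: close_def)
        then show ?thesis using 0(1,2) by blast
      next
        case False
        then have eq: "\<forall>\<rho>\<in>assigns A. \<rho> 1 = \<rho> 2 \<longrightarrow> eval A \<rho> s = eval A \<rho> t"
          using step.hyps by (auto simp: jonsson_step_def)
        \<comment> \<open>The terms agree only at \<open>(x, y, y)\<close>, which forces a detour in
          three steps: from \<open>x\<close> to \<open>s(x,x,y)\<close>, on to
          \<open>s(x,y,y) = t(x,y,y)\<close>, and back to \<open>t(x,x,y)\<close>. The last step
          reverses a pair, hence the symmetry.\<close>
        obtain W1 where W1: "W1 \<in> entourages ?S \<W>" "sym W1" "W1 O W1 O W1 \<subseteq> W0"
          using uniformity_third_sym[OF W(1) W0] by blast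
        have s: "wf_trm sig s" "\<And>\<rho>. \<rho> \<in> assigns A \<Longrightarrow> \<rho> 0 = \<rho> 2 \<Longrightarrow> eval A \<rho> s = \<rho> 0"
          using step.hyps idem[of s] by (auto simp: rtrancl_eq_or_trancl)
        have t: "wf_trm sig t" "\<And>\<rho>. \<rho> \<in> assigns A \<Longrightarrow> \<rho> 0 = \<rho> 2 \<Longrightarrow> eval A \<rho> t = \<rho> 0"
          using idem[OF rtrancl_into_trancl1[OF step.hyps]] by auto
        obtain U1 V1 where 1: "U1 \<in> entourages ?S \<U>" "V1 \<in> entourages ?S \<V>"
          "close W1 s U1 V1"
          using step.IH W1(1) by blast
        obtain U2 V2 where 2: "U2 \<in> entourages ?S \<U>" "V2 \<in> entourages ?S \<V>"
          "\<And>x y. (x, y) \<in> U2 \<inter> V2 \<Longrightarrow> (eval A (assign3 x x y) s, eval A (assign3 x y y) s) \<in> W1"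
          using term_condition_middle[OF W U s W1(1)] by blast
        obtain U3 V3 where 3: "U3 \<in> entourages ?S \<U>" "V3 \<in> entourages ?S \<V>"
          "\<And>x y. (x, y) \<in> U3 \<inter> V3 \<Longrightarrow> (eval A (assign3 x x y) t, eval A (assign3 x y y) t) \<in> W1"
          using term_condition_middle[OF W U t W1(1)] by blast
        have "(x, eval A (assign3 x x y) t) \<in> W0"
          if xy: "(x, y) \<in> (U1 \<inter> U2 \<inter> U3) \<inter> (V1 \<inter> V2 \<inter> V3)" for x y
        proof -
          have "x \<in> ?S" "y \<in> ?S" using xy entouragesD[OF 1(1)] by auto
          then have "eval A (assign3 x y y) s = eval A (assign3 x y y) t" using eq by simp
          then have "(eval A (assign3 x y y) s, eval A (assign3 x x y) t) \<in> W1"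
            using 3(3) xy W1(2) by (auto dest: symD)
          moreover have "(x, eval A (assign3 x x y) s) \<in> W1"
            "(eval A (assign3 x x y) s, eval A (assign3 x y y) s) \<in> W1"
            using 1(3) 2(3) xy by (auto simp: close_def)
          ultimately show ?thesis using W1(3) by blast
        qed
        then have "close W0 t (U1 \<inter> U2 \<inter> U3) (V1 \<inter> V2 \<inter> V3)" unfolding close_def by blast
        moreover have "U1 \<inter> U2 \<inter> U3 \<in> entourages ?S \<U>" "V1 \<inter> V2 \<inter> V3 \<in> entourages ?S \<V>"
          using 1 2 3 by (simp_all add: entourages_Int)
        ultimately show ?thesis by blast
      qed
    qed
  qed
  have "W0 \<in> entourages ?S (inf \<U> \<V>)" if W0: "W0 \<in> entourages ?S \<W>" for W0
  proof -
    obtain U0 V0 where 0: "U0 \<in> entourages ?S \<U>" "V0 \<in> entourages ?S \<V>" "close W0 (Var 2) U0 V0"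
      using chain_close[OF trancl_into_rtrancl[OF chain]] W0 by blast
    have "U0 \<inter> V0 \<subseteq> W0" using 0(3) by (auto simp: close_def)
    with 0(1,2) have "\<exists>U\<in>entourages ?S \<U>. \<exists>V\<in>entourages ?S \<V>. U \<inter> V \<subseteq> W0" by blast
    then show ?thesis unfolding entourages_inf[OF le(1,2)] using entouragesD[OF W0] by blast
  qed
  then show ?thesis
    using le by (subst entourages_mono[where S = ?S]) (auto intro: le_infI1)
qed

theorem theorem9p2:
  fixes sig :: "'f \<rightharpoonup> nat"
    and E :: "(('f, nat) trm \<times> ('f, nat) trm) set"
    and A :: "('f, 'a) alg"
    and \<U> \<V> :: "('a \<times> 'a) filter"
  assumes "identities sig E"
    and "congruence_distributive TYPE(('f, nat) trm set) sig E"
    and "A \<in> variety sig E"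
    and "\<U> \<in> Unif sig A"
    and "\<V> \<in> Unif sig A"
  shows "commutator sig A \<U> \<V> = inf \<U> \<V>"
  unfolding commutator_def
proof (rule Least_equality)
  show "inf \<U> \<V> \<in> Unif sig A \<and> term_condition sig A \<U> \<V> (inf \<U> \<V>)"
    using assms(4,5) Unif_inf term_condition_inf by blast
next
  fix \<W> assume "\<W> \<in> Unif sig A \<and> term_condition sig A \<U> \<V> \<W>"
  then show "inf \<U> \<V> \<le> \<W>"
    using inf_le_term_condition[OF jonsson_chain[OF assms(1-3)]] assms(4,5) by (auto simp: Unif_def)
qed

end
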